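(* For every cube $Q\subset\mathbb R^n$, all $0<\delta<1$, $1<p<\min\bigl\{\frac n\delta,\frac1{1-\delta}\bigr\}$ and $p\leq q\leq\frac{np}{n-\delta p}$, with $\alpha=n-\frac qp(n-\delta p)$, and every $C>0$, there exist a Radon measure $\mu$ on $\mathbb R^n$ with $\mu\ll\mathcal L$ and a Lipschitz function $f$ such that \[ \biggl(\int_Q|f-f_Q|^q\,d\mu\biggr)^{\frac1q}>C(1-\delta)^{\frac1p}\biggl(\int_Q\int_Q\frac{|f(x)-f(y)|^p}{|x-y|^{n+\delta p}}\,dy\,(\mathrm M_\alpha\mu(x))^{\frac pq}\,dx\biggr)^{\frac1p}. \]
   Context: $\mathcal L$ is Lebesgue measure on $\mathbb R^n$; $\mu\ll\mathcal L$ means that $\mathcal L(A)=0$ implies $\mu(A)=0$. A cube is a closed axis-parallel cube in $\mathbb R^n$, with side length $\mathrm l(Q)$. $f_Q=\frac1{\mathcal L(Q)}\int_Qf\,dx$. The fractional maximal function is $\mathrm M_\alpha\mu(x)=\sup_{Q\ni x}\mathrm l(Q)^\alpha\frac{\mu(Q)}{\mathcal L(Q)}$, the supremum over all cubes $Q\subset\mathbb R^n$ containing $x$. *)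

theory Defs
  imports "HOL-Analysis.Analysis"
begin

text \<open>The closed axis-parallel cube with lower corner \<open>a\<close> and side length \<open>l\<close>.\<close>

definition cube :: "real ^ 'n \<Rightarrow> real \<Rightarrow> (real ^ 'n) set" where
  "cube a l = cbox a (\<chi> i. a $ i + l)"

definition is_cube :: "(real ^ 'n) set \<Rightarrow> bool" where
  "is_cube Q \<longleftrightarrow> (\<exists>a l. 0 < l \<and> Q = cube a l)"

text \<open>Powers with exponent \<open>a > 0\<close> on the extended half-line, where \<open>\<infinity>\<close> is mapped to \<open>\<infinity>\<close>.\<close>

definition ennpowr :: "ennreal \<Rightarrow> real \<Rightarrow> ennreal" where
  "ennpowr x a = (if x = \<infinity> then \<infinity> else ennreal (enn2real x powr a))"

definition radon_measure :: "'a::topological_space measure \<Rightarrow> bool" where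
  "radon_measure M \<longleftrightarrow>
     sets M = sets borel \<and>
     (\<forall>K. compact K \<longrightarrow> emeasure M K < \<infinity>) \<and>
     (\<forall>A\<in>sets borel. emeasure M A = (SUP K\<in>{K. K \<subseteq> A \<and> compact K}. emeasure M K))"

definition average :: "(real ^ 'n) set \<Rightarrow> (real ^ 'n \<Rightarrow> real) \<Rightarrow> real" where
  "average Q f = (LINT x:Q|lborel. f x) / measure lborel Q"

definition frac_maximal :: "real \<Rightarrow> (real ^ 'n) measure \<Rightarrow> real ^ 'n \<Rightarrow> ennreal" where
  "frac_maximal \<alpha> \<mu> x =
     (SUP (a, l)\<in>{(a, l). 0 < l \<and> x \<in> cube a l}.
        ennreal (l powr \<alpha>) * (emeasure \<mu> (cube a l) / emeasure lborel (cube a l)))"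

end

theory Submission
  imports Defs "HOL-Real_Asymp.Real_Asymp"
begin

text \<open>
  The pair \<open>p, q, \<alpha>\<close> is critical for a point mass: if \<open>\<mu>\<close> is a unit mass at \<open>c\<close>, then
  \<open>(M\<^sub>\<alpha> \<mu>)\<^bsup>p/q\<^esup>\<close> is comparable to \<open>|x - c|\<^bsup>\<delta>p - n\<^esup>\<close>, so that the weighted seminorm is invariant under
  dilations about \<open>c\<close>. A function growing logarithmically towards \<open>c\<close> exploits this. Spread the mass
  uniformly over the ball of radius \<open>\<epsilon>\<close> about the centre \<open>c\<close> of the cube and take
  \<open>f x = - ln (max |x - c| \<epsilon>)\<close>. The left-hand side grows like \<open>L = ln (1/\<epsilon>)\<close>. With
  \<open>r = max |x - c| \<epsilon>\<close>, the inner integral is at most a constant times \<open>r\<^bsup>-\<delta>p\<^esup>\<close>, hence the outer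
  integrand is at most a constant times \<open>r\<^bsup>-n\<^esup>\<close>, whose integral is of order \<open>L\<close>. So the right-hand side
  is of order \<open>L\<^bsup>1/p\<^esup>\<close>, which is smaller than \<open>L\<close> because \<open>p > 1\<close>.
\<close>

section \<open>Radial integrals\<close>

text \<open>The pushforward of Lebesgue measure under \<open>dist c\<close> has as its density the
  derivative of the ball volume. It suffices to compare the two measures on half-lines, an
  intersection-stable generator exhausted by sets of finite measure.\<close>

lemma nn_integral_dist_polar:
  fixes c :: "'a::euclidean_space" and h :: "real \<Rightarrow> ennreal"
  assumes [measurable]: "h \<in> borel_measurable borel"
  shows "(\<integral>\<^sup>+z. h (dist c z) \<partial>lborel) =
    (\<integral>\<^sup>+r. ennreal (DIM('a) * unit_ball_vol DIM('a) * r ^ (DIM('a) - 1)) * indicator {0..} r * h r \<partial>lborel)"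
proof -
  define k :: "real \<Rightarrow> real" where "k r = DIM('a) * unit_ball_vol DIM('a) * r ^ (DIM('a) - 1)" for r
  have [measurable]: "k \<in> borel_measurable borel" unfolding k_def by measurable
  let ?N = "density lborel (\<lambda>r. ennreal (k r) * indicator {0..} r)"
  \<comment> \<open>For nonnegative \<open>a\<close> both sides equal the volume of
    \<open>cball c a\<close>, the right one by the fundamental theorem of calculus; for negative
    \<open>a\<close> both vanish.\<close>
  have kz: "emeasure (distr lborel borel (dist c)) {..a} = emeasure ?N {..a}" for a :: real
  proof -
    have "emeasure (distr lborel borel (dist c)) {..a} = emeasure lborel (cball c a)"
      by (subst emeasure_distr) (auto simp: cball_def vimage_def)
    also have "\<dots> = emeasure ?N {..a}"
    proof (cases "a \<ge> 0")
      case True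
      have "emeasure ?N {..a} = (\<integral>\<^sup>+r. ennreal (k r) * indicator {0..a} r \<partial>lborel)"
        by (subst emeasure_density) (auto intro!: nn_integral_cong split: split_indicator)
      also have "\<dots> = ennreal (unit_ball_vol DIM('a) * a ^ DIM('a) - unit_ball_vol DIM('a) * 0 ^ DIM('a))"
        using True unfolding k_def
        by (intro nn_integral_FTC_Icc) (auto intro!: derivative_eq_intros)
      finally show ?thesis using True by (simp add: emeasure_cball)
    next
      case False
      then have "(\<lambda>r. ennreal (k r) * indicator {0..} r * indicator {..a} r) = (\<lambda>_. 0)"
        by (auto simp: fun_eq_iff split: split_indicator)
      then have "emeasure ?N {..a} = 0"
        by (subst emeasure_density) simp_all
      then show ?thesis using False by simp
    qed
    finally show ?thesis .
  qed
  have "distr lborel borel (dist c) = ?N"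
  proof (rule measure_eqI_generator_eq[where E="range atMost" and \<Omega>=UNIV and A="\<lambda>i. {..real i}"])
    show "Int_stable (range (atMost :: real \<Rightarrow> _))"
      by (auto simp: Int_stable_def)
    show "sets (distr lborel borel (dist c)) = sigma_sets UNIV (range atMost)"
      by (simp add: borel_eq_atMost)
    show "sets ?N = sigma_sets UNIV (range atMost)"
      by (simp add: borel_eq_atMost)
    show "(\<Union>i. {..real i}) = UNIV" by (auto simp: real_arch_simple)
    show "emeasure (distr lborel borel (dist c)) {..real i} \<noteq> \<infinity>" for i
    proof -
      have "emeasure (distr lborel borel (dist c)) {..real i} = emeasure lborel (cball c (real i))"
        by (subst emeasure_distr) (auto simp: cball_def vimage_def)
      then show ?thesis by (simp add: emeasure_cball)
    qed
  qed (use kz in auto)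
  then have "(\<integral>\<^sup>+r. h r \<partial>distr lborel borel (dist c)) = (\<integral>\<^sup>+r. h r \<partial>?N)" by simp
  then show ?thesis
    by (simp add: nn_integral_distr nn_integral_density k_def)
qed

text \<open>In polar form the integrand is a multiple of \<open>r powr (a + DIM('a) - 1)\<close>,
  which is integrable at 0 exactly because \<open>a + DIM('a)\<close> is positive. This controls
  every local singularity below.\<close>

lemma nn_integral_dist_powr_cball:
  fixes c :: "'a::euclidean_space" and a R :: real
  assumes "0 < a + DIM('a)" "0 \<le> R"
  shows "(\<integral>\<^sup>+z. ennreal (dist c z powr a) * indicator (cball c R) z \<partial>lborel)
    = ennreal (DIM('a) * unit_ball_vol DIM('a) / (a + DIM('a)) * R powr (a + DIM('a)))"
proof -
  let ?w = "DIM('a) * unit_ball_vol DIM('a)"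
  have "(\<integral>\<^sup>+z. ennreal (dist c z powr a) * indicator (cball c R) z \<partial>lborel) =
      (\<integral>\<^sup>+z. ennreal (dist c z powr a) * indicator {..R} (dist c z) \<partial>lborel)"
    by (intro nn_integral_cong) (auto split: split_indicator)
  also have "\<dots> = (\<integral>\<^sup>+r. ennreal (?w * r ^ (DIM('a) - 1)) * indicator {0..} r *
      (ennreal (r powr a) * indicator {..R} r) \<partial>lborel)"
    by (rule nn_integral_dist_polar) measurable
  also have "\<dots> = (\<integral>\<^sup>+r. ennreal ?w * (ennreal (r powr (a + DIM('a) - 1)) * indicator {0..R} r) \<partial>lborel)"
  proof (rule nn_integral_cong_AE, rule AE_mp[OF AE_lborel_singleton[of 0]], rule AE_I2, rule impI)
    fix r :: real assume "r \<noteq> 0"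
    show "ennreal (?w * r ^ (DIM('a) - 1)) * indicator {0..} r * (ennreal (r powr a) * indicator {..R} r)
      = ennreal ?w * (ennreal (r powr (a + DIM('a) - 1)) * indicator {0..R} r)"
    proof (cases "0 < r \<and> r \<le> R")
      case True
      have "r ^ (DIM('a) - 1) * r powr a = r powr (a + DIM('a) - 1)"
        using True by (simp add: powr_realpow[symmetric] powr_add[symmetric] of_nat_diff algebra_simps)
      then show ?thesis using True
        by (simp add: ennreal_mult[symmetric] mult.assoc)
    qed (use \<open>r \<noteq> 0\<close> in \<open>auto simp: indicator_def\<close>)
  qed
  also have "\<dots> = ennreal ?w * (\<integral>\<^sup>+r. ennreal (r powr (a + DIM('a) - 1)) * indicator {0..R} r \<partial>lborel)"
    by (rule nn_integral_cmult) measurable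
  also have "\<dots> = ennreal ?w * ennreal (R powr (a + DIM('a) - 1 + 1) / (a + DIM('a) - 1 + 1))"
    using assms by (subst nn_integral_has_integral_lebesgue'[OF _ has_integral_powr_from_0]) auto
  also have "\<dots> = ennreal (?w / (a + DIM('a)) * R powr (a + DIM('a)))"
    using assms by (subst ennreal_mult[symmetric]) auto
  finally show ?thesis .
qed

text \<open>The counterpart at infinity: now \<open>a + DIM('a)\<close> is negative and the tail
  converges. It supplies the far part of the fractional energy.\<close>

lemma nn_integral_dist_powr_outside:
  fixes c :: "'a::euclidean_space" and a R :: real
  assumes "a + DIM('a) < 0" "0 < R"
  shows "(\<integral>\<^sup>+z. ennreal (dist c z powr a) * indicator (- ball c R) z \<partial>lborel)
    = ennreal (DIM('a) * unit_ball_vol DIM('a) / (- a - DIM('a)) * R powr (a + DIM('a)))"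
proof -
  let ?w = "DIM('a) * unit_ball_vol DIM('a)"
  have "(\<integral>\<^sup>+z. ennreal (dist c z powr a) * indicator (- ball c R) z \<partial>lborel) =
      (\<integral>\<^sup>+z. ennreal (dist c z powr a) * indicator {R..} (dist c z) \<partial>lborel)"
    by (intro nn_integral_cong) (auto split: split_indicator)
  also have "\<dots> = (\<integral>\<^sup>+r. ennreal (?w * r ^ (DIM('a) - 1)) * indicator {0..} r *
      (ennreal (r powr a) * indicator {R..} r) \<partial>lborel)"
    by (rule nn_integral_dist_polar) measurable
  also have "\<dots> = (\<integral>\<^sup>+r. ennreal ?w * (ennreal (r powr (a + DIM('a) - 1)) * indicator {R..} r) \<partial>lborel)"
  proof (rule nn_integral_cong)
    fix r :: real
    show "ennreal (?w * r ^ (DIM('a) - 1)) * indicator {0..} r * (ennreal (r powr a) * indicator {R..} r)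
      = ennreal ?w * (ennreal (r powr (a + DIM('a) - 1)) * indicator {R..} r)"
    proof (cases "R \<le> r")
      case True
      have "r ^ (DIM('a) - 1) * r powr a = r powr (a + DIM('a) - 1)"
        using True \<open>0 < R\<close> by (simp add: powr_realpow[symmetric] powr_add[symmetric] of_nat_diff algebra_simps)
      then show ?thesis using True \<open>0 < R\<close>
        by (simp add: ennreal_mult[symmetric] mult.assoc)
    qed (auto simp: indicator_def)
  qed
  also have "\<dots> = ennreal ?w * (\<integral>\<^sup>+r. ennreal (r powr (a + DIM('a) - 1)) * indicator {R..} r \<partial>lborel)"
    by (rule nn_integral_cmult) measurable
  also have "\<dots> = ennreal ?w * ennreal (- (R powr (a + DIM('a) - 1 + 1)) / (a + DIM('a) - 1 + 1))"
    using assms by (subst nn_integral_has_integral_lebesgue'[OF _ has_integral_powr_to_inf]) auto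
  also have "\<dots> = ennreal (?w / (- a - DIM('a)) * R powr (a + DIM('a)))"
  proof -
    have "x / (- a - DIM('a)) = - (x / (a + DIM('a)))" for x
      using minus_divide_right[of x "a + DIM('a)"] by simp
    then show ?thesis
      using assms by (subst ennreal_mult[symmetric]) (auto simp: divide_nonneg_neg)
  qed
  finally show ?thesis .
qed

text \<open>The exponent is the borderline one: the shell between radii \<open>\<epsilon>\<close>
  and \<open>R\<close> contributes a logarithm, while the truncated core contributes the
  scale-invariant constant \<open>unit_ball_vol DIM('a)\<close>.\<close>

lemma nn_integral_truncated_critical_powr:
  fixes c :: "'a::euclidean_space" and R \<epsilon> :: real
  assumes "0 < \<epsilon>" "\<epsilon> \<le> R"
  shows "(\<integral>\<^sup>+z. ennreal (max (dist c z) \<epsilon> powr (- real DIM('a))) * indicator (cball c R) z \<partial>lborel)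
    \<le> ennreal (unit_ball_vol DIM('a) * (1 + DIM('a) * ln (R / \<epsilon>)))"
proof -
  let ?v = "unit_ball_vol DIM('a)"
  define h :: "real \<Rightarrow> ennreal" where "h r = ennreal (r powr (- real DIM('a))) * indicator {\<epsilon>..R} r" for r
  have [measurable]: "cball c \<epsilon> \<in> sets borel" "h \<in> borel_measurable borel"
    unfolding h_def by (simp, measurable)
  \<comment> \<open>Ball and closed shell overlap on the sphere of radius \<open>\<epsilon>\<close>,
    so the splitting is stated as an inequality.\<close>
  have "(\<integral>\<^sup>+z. ennreal (max (dist c z) \<epsilon> powr (- real DIM('a))) * indicator (cball c R) z \<partial>lborel) \<le>
      (\<integral>\<^sup>+z. ennreal (\<epsilon> powr (- real DIM('a))) * indicator (cball c \<epsilon>) z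
         + h (dist c z) \<partial>lborel)"
    by (intro nn_integral_mono) (auto split: split_indicator simp: max_def h_def)
  also have "\<dots> = (\<integral>\<^sup>+z. ennreal (\<epsilon> powr (- real DIM('a))) * indicator (cball c \<epsilon>) z \<partial>lborel)
      + (\<integral>\<^sup>+z. h (dist c z) \<partial>lborel)"
    by (rule nn_integral_add; measurable)
  also have "(\<integral>\<^sup>+z. ennreal (\<epsilon> powr (- real DIM('a))) * indicator (cball c \<epsilon>) z \<partial>lborel) = ennreal ?v"
  proof -
    have "\<epsilon> powr (- real DIM('a)) * (?v * \<epsilon> ^ DIM('a)) = ?v"
      using \<open>0 < \<epsilon>\<close> by (simp add: powr_minus powr_realpow)
    then show ?thesis
      using \<open>0 < \<epsilon>\<close>
      by (simp add: nn_integral_cmult_indicator emeasure_cball flip: ennreal_mult)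
  qed
  also have "(\<integral>\<^sup>+z. h (dist c z) \<partial>lborel) =
      (\<integral>\<^sup>+r. ennreal (DIM('a) * ?v * r ^ (DIM('a) - 1)) * indicator {0..} r *
      h r \<partial>lborel)"
    by (rule nn_integral_dist_polar) measurable
  also have "\<dots> = (\<integral>\<^sup>+r. ennreal (DIM('a) * ?v / r) * indicator {\<epsilon>..R} r \<partial>lborel)"
  proof (rule nn_integral_cong)
    fix r :: real
    show "ennreal (DIM('a) * ?v * r ^ (DIM('a) - 1)) * indicator {0..} r *
      h r = ennreal (DIM('a) * ?v / r) * indicator {\<epsilon>..R} r"
    proof (cases "\<epsilon> \<le> r")
      case True
      have "r ^ (DIM('a) - 1) * r powr (- real DIM('a)) = 1 / r"
        using True \<open>0 < \<epsilon>\<close>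
        by (simp add: powr_realpow[symmetric] powr_add[symmetric] of_nat_diff powr_minus powr_diff inverse_eq_divide)
      then show ?thesis using True \<open>0 < \<epsilon>\<close>
        by (auto simp: h_def ennreal_mult[symmetric] mult.assoc split: split_indicator)
    qed (auto simp: indicator_def h_def)
  qed
  also have "\<dots> = ennreal (DIM('a) * ?v * ln R - DIM('a) * ?v * ln \<epsilon>)"
    using assms by (intro nn_integral_FTC_Icc) (auto intro!: derivative_eq_intros)
  also have "ennreal ?v + \<dots> = ennreal (?v * (1 + DIM('a) * ln (R / \<epsilon>)))"
    using assms by (subst ennreal_plus[symmetric]) (auto simp: ln_div algebra_simps intro!: mult_left_mono)
  finally show ?thesis .
qed

section \<open>The fractional energy of a truncated logarithm\<close>

text \<open>
  Here \<open>a, b\<close> are the truncated distances of \<open>x, y\<close> to \<open>c\<close>, \<open>d = dist x y\<close> and \<open>e = dist c y\<close>. The three summands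
  dominate in the cases \<open>y\<close> near \<open>x\<close>, \<open>y\<close> far and further out than \<open>x\<close>, \<open>y\<close> far and closer to \<open>c\<close>; for small
  \<open>s, t\<close> each of them is integrable in \<open>y\<close>.
\<close>
lemma abs_ln_diff_powr_le:
  fixes a b d e s t p m :: real
  assumes pos: "0 < a" "0 < e" "e \<le> b" "0 < s" "0 < t" "0 < p" "0 \<le> m" and ab: "\<bar>a - b\<bar> \<le> d"
  shows "\<bar>ln a - ln b\<bar> powr p / d powr m \<le>
    (2 / a) powr p * (d powr (p - m) * indicator {..a / 2} d)
    + ((3 / a) powr s / s) powr p * (d powr (s * p - m) * indicator {a / 2..} d)
    + (a powr t / t) powr p * (a / 2) powr (- m) * (e powr (- t * p) * indicator {..a} e)"
    (is "_ \<le> ?A + ?B + ?C")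
proof -
  have "0 < b" using pos by linarith
  have nonneg: "0 \<le> ?A" "0 \<le> ?B" "0 \<le> ?C" by auto
  consider "d = 0" | "0 < d" "d \<le> a / 2" | "a / 2 < d" "a \<le> b" | "a / 2 < d" "b < a"
    using ab by linarith
  then show ?thesis
  proof cases
    case 1
    \<comment> \<open>\<open>d powr m\<close> is 0 here, and division by zero yields 0.\<close>
    then have "\<bar>ln a - ln b\<bar> powr p / d powr m = 0" by simp
    then show ?thesis using nonneg by linarith
  next
    case 2
    \<comment> \<open>Since \<open>b\<close> is at least \<open>a - d\<close>, both \<open>a\<close>
      and \<open>b\<close> are at least \<open>a / 2\<close>, and the logarithm is Lipschitz there
      with constant \<open>2 / a\<close>.\<close>
    have "ln a - ln b \<le> (a - b) / b" "ln b - ln a \<le> (b - a) / a"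
      using ln_diff_le \<open>0 < a\<close> \<open>0 < b\<close> by auto
    moreover have "(a - b) / b \<le> d / (a / 2)"
      using 2 ab \<open>0 < a\<close> by (intro frac_le) auto
    moreover have "(b - a) / a \<le> d / (a / 2)"
      using 2 ab \<open>0 < a\<close> by (intro frac_le) auto
    ultimately have "\<bar>ln a - ln b\<bar> \<le> 2 / a * d" by (simp add: field_simps)
    then have "\<bar>ln a - ln b\<bar> powr p / d powr m \<le> (2 / a * d) powr p / d powr m"
      using \<open>0 < p\<close> by (intro divide_right_mono powr_mono2) auto
    also have "\<dots> = ?A"
      using 2 \<open>0 < a\<close> by (simp add: powr_mult powr_divide powr_diff)
    finally show ?thesis using nonneg by linarith
  next
    case 3
    \<comment> \<open>From \<open>a < 2 * d\<close> follows
      \<open>b \<le> a + d \<le> 3 * d\<close>, so a small power of \<open>d\<close> dominates the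
      logarithm.\<close>
    have "\<bar>ln a - ln b\<bar> = ln (b / a)"
      using 3 \<open>0 < a\<close> \<open>0 < b\<close> by (simp add: ln_div)
    also have "\<dots> \<le> (b / a) powr s / s"
      using 3 \<open>0 < a\<close> \<open>0 < s\<close> by (intro ln_powr_bound) auto
    also have "\<dots> \<le> (3 / a * d) powr s / s"
      using 3 ab \<open>0 < a\<close> \<open>0 < b\<close> \<open>0 < s\<close>
      by (intro divide_right_mono powr_mono2) (auto simp: divide_right_mono)
    also have "\<dots> = (3 / a) powr s / s * d powr s"
      using 3 \<open>0 < a\<close> by (simp add: powr_mult powr_divide)
    finally have "\<bar>ln a - ln b\<bar> powr p / d powr m \<le> ((3 / a) powr s / s * d powr s) powr p / d powr m"
      using \<open>0 < p\<close> by (intro divide_right_mono powr_mono2) auto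
    also have "\<dots> = ?B"
      using 3 \<open>0 < a\<close> \<open>0 < s\<close> by (simp add: powr_mult powr_divide powr_diff powr_powr)
    finally show ?thesis using nonneg by linarith
  next
    case 4
    \<comment> \<open>The kernel is frozen at distance \<open>a / 2\<close>; the logarithm is
      absorbed by a small negative power of \<open>e\<close>, and \<open>e \<le> b < a\<close> makes
      the indicator equal to 1.\<close>
    have "\<bar>ln a - ln b\<bar> = ln (a / b)"
      using 4 \<open>0 < a\<close> \<open>0 < b\<close> by (simp add: ln_div)
    also have "\<dots> \<le> (a / b) powr t / t"
      using 4 \<open>0 < b\<close> \<open>0 < t\<close> by (intro ln_powr_bound) auto
    also have "\<dots> \<le> (a / e) powr t / t"
      using 4 pos \<open>0 < b\<close>
      by (intro divide_right_mono powr_mono2) (auto intro: divide_left_mono)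
    finally have "\<bar>ln a - ln b\<bar> powr p \<le> ((a / e) powr t / t) powr p"
      using \<open>0 < p\<close> by (intro powr_mono2) auto
    moreover have "1 / d powr m \<le> (a / 2) powr (- m)"
      using 4 \<open>0 < a\<close> \<open>0 \<le> m\<close> by (auto simp: powr_minus inverse_eq_divide intro!: divide_left_mono powr_mono2)
    ultimately have "\<bar>ln a - ln b\<bar> powr p / d powr m \<le> ((a / e) powr t / t) powr p * (a / 2) powr (- m)"
      unfolding divide_inverse[of "_ powr p"] inverse_eq_divide by (intro mult_mono) auto
    also have "\<dots> = ?C"
      using 4 pos by (simp add: powr_divide powr_mult powr_powr powr_minus field_simps)
    finally show ?thesis using nonneg by linarith
  qed
qed

text \<open>Differences of logarithms are scale-free, so the integral must scale like the truncated
  distance to the power \<open>- \<delta> * p\<close>. What matters is that \<open>K\<close> is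
  independent of \<open>c\<close>, \<open>x\<close> and \<open>\<epsilon>\<close>.\<close>

lemma truncated_log_energy_bound:
  fixes \<delta> p :: real
  assumes "0 < \<delta>" "\<delta> < 1" "0 < p"
  obtains K where "0 \<le> K"
    and "\<And>(c :: 'a::euclidean_space) x \<epsilon>. 0 < \<epsilon> \<Longrightarrow>
      (\<integral>\<^sup>+y. ennreal (\<bar>ln (max (dist c x) \<epsilon>) - ln (max (dist c y) \<epsilon>)\<bar> powr p
          / dist x y powr (DIM('a) + \<delta> * p)) \<partial>lborel)
        \<le> ennreal (K * max (dist c x) \<epsilon> powr (- \<delta> * p))"
proof -
  define n where "n = real DIM('a)"
  \<comment> \<open>Integrability needs \<open>s < \<delta>\<close> at infinity and \<open>t * p < n\<close> at \<open>c\<close>.\<close>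
  define s where "s = \<delta> / 2"
  define t where "t = n / (2 * p)"
  define m where "m = n + \<delta> * p"
  define w where "w = n * unit_ball_vol n"
  have n: "0 < n" by (simp add: n_def)
  have pos: "0 < s" "0 < t" "0 \<le> m" "0 \<le> w"
    using assms n by (auto simp: s_def t_def m_def w_def)
  have sp: "s * p = \<delta> * p / 2" "p * s = \<delta> * p / 2" and tp: "t * p = n / 2" "p * t = n / 2"
    using assms by (auto simp: s_def t_def)
  have dp: "\<delta> * p < p" "0 < \<delta> * p" using assms by auto
  \<comment> \<open>These are the integrals of the three summands in
    \<open>abs_ln_diff_powr_le\<close>, with \<open>\<rho> powr (- \<delta> * p)\<close> factored
    out.\<close>
  define K1 where "K1 = w / (p - \<delta> * p) * 2 powr (\<delta> * p)"
  define K2 where "K2 = (1 / s) powr p * 3 powr (\<delta> * p / 2) * (w / (\<delta> * p / 2)) * 2 powr (\<delta> * p / 2)"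
  define K3 where "K3 = (1 / t) powr p * 2 powr m * (w / (n / 2))"
  have K: "0 \<le> K1" "0 \<le> K2" "0 \<le> K3"
    using pos n dp assms by (auto simp: K1_def K2_def K3_def intro!: mult_nonneg_nonneg divide_nonneg_nonneg)
  show thesis
  proof (rule that)
    show "0 \<le> K1 + K2 + K3" using K by simp
    fix c x :: 'a and \<epsilon> :: real
    assume "0 < \<epsilon>"
    define \<rho> where "\<rho> = max (dist c x) \<epsilon>"
    define A where "A = (2 / \<rho>) powr p"
    define B where "B = ((3 / \<rho>) powr s / s) powr p"
    define C where "C = (\<rho> powr t / t) powr p * (\<rho> / 2) powr (- m)"
    let ?f = "\<lambda>y. ennreal (dist x y powr (p - m)) * indicator (cball x (\<rho> / 2)) y"
    let ?g = "\<lambda>y. ennreal (dist x y powr (s * p - m)) * indicator (- ball x (\<rho> / 2)) y"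
    let ?h = "\<lambda>y. ennreal (dist c y powr (- t * p)) * indicator (cball c \<rho>) y"
    have "0 < \<rho>" using \<open>0 < \<epsilon>\<close> by (simp add: \<rho>_def)
    have ABC: "0 \<le> A" "0 \<le> B" "0 \<le> C" by (auto simp: A_def B_def C_def)
    have [measurable]: "cball x (\<rho> / 2) \<in> sets borel" "- ball x (\<rho> / 2) \<in> sets borel"
      "cball c \<rho> \<in> sets borel" by auto
    have "(\<integral>\<^sup>+y. ennreal (\<bar>ln \<rho> - ln (max (dist c y) \<epsilon>)\<bar> powr p / dist x y powr m) \<partial>lborel) \<le>
        (\<integral>\<^sup>+y. (ennreal A * ?f y + ennreal B * ?g y) + ennreal C * ?h y \<partial>lborel)"
    \<comment> \<open>The null set where \<open>y = c\<close> is discarded because the pointwise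
      bound needs \<open>dist c y\<close> to be positive.\<close>
    proof (rule nn_integral_mono_AE, rule AE_mp[OF AE_lborel_singleton[of c]], rule AE_I2, rule impI)
      fix y assume "y \<noteq> c"
      have "\<bar>\<rho> - max (dist c y) \<epsilon>\<bar> \<le> dist x y"
        using dist_triangle[of c x y] dist_triangle[of c y x] by (auto simp: \<rho>_def dist_commute max_def)
      then have "\<bar>ln \<rho> - ln (max (dist c y) \<epsilon>)\<bar> powr p / dist x y powr m \<le>
          A * (dist x y powr (p - m) * indicator {..\<rho> / 2} (dist x y))
          + B * (dist x y powr (s * p - m) * indicator {\<rho> / 2..} (dist x y))
          + C * (dist c y powr (- t * p) * indicator {..\<rho>} (dist c y))"
        unfolding A_def B_def C_def using \<open>0 < \<rho>\<close> pos assms \<open>y \<noteq> c\<close>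
        by (intro abs_ln_diff_powr_le) auto
      then have "ennreal (\<bar>ln \<rho> - ln (max (dist c y) \<epsilon>)\<bar> powr p / dist x y powr m) \<le> ennreal (
          A * (dist x y powr (p - m) * indicator {..\<rho> / 2} (dist x y))
          + B * (dist x y powr (s * p - m) * indicator {\<rho> / 2..} (dist x y))
          + C * (dist c y powr (- t * p) * indicator {..\<rho>} (dist c y)))"
        by (rule ennreal_leI)
      also have "\<dots> = (ennreal A * ?f y + ennreal B * ?g y) + ennreal C * ?h y"
        using ABC by (simp add: ennreal_mult ennreal_plus[symmetric] del: ennreal_plus)
           (simp add: ennreal_mult ennreal_indicator[symmetric] indicator_def)
      finally show "ennreal (\<bar>ln \<rho> - ln (max (dist c y) \<epsilon>)\<bar> powr p / dist x y powr m) \<le> \<dots>" .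
    qed
    also have "\<dots> = ennreal A * (\<integral>\<^sup>+y. ?f y \<partial>lborel) + ennreal B * (\<integral>\<^sup>+y. ?g y \<partial>lborel)
        + ennreal C * (\<integral>\<^sup>+y. ?h y \<partial>lborel)"
      by (simp add: nn_integral_add nn_integral_cmult)
    \<comment> \<open>After adding the dimension, the three exponents are
      \<open>p - \<delta> * p\<close>, \<open>- (\<delta> * p / 2)\<close> and \<open>n / 2\<close>,
      each of the sign that convergence requires.\<close>
    also have "(\<integral>\<^sup>+y. ?f y \<partial>lborel) = ennreal (w / (p - \<delta> * p) * (\<rho> / 2) powr (p - \<delta> * p))"
      using nn_integral_dist_powr_cball[of "p - m" "\<rho> / 2" x] dp \<open>0 < \<rho>\<close>
      by (simp add: w_def m_def n_def)
    also have "(\<integral>\<^sup>+y. ?g y \<partial>lborel) = ennreal (w / (\<delta> * p / 2) * (\<rho> / 2) powr (- (\<delta> * p / 2)))"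
      using nn_integral_dist_powr_outside[of "s * p - m" "\<rho> / 2" x] dp \<open>0 < \<rho>\<close>
      by (simp add: w_def m_def n_def sp)
    also have "(\<integral>\<^sup>+y. ?h y \<partial>lborel) = ennreal (w / (n / 2) * \<rho> powr (n / 2))"
      using nn_integral_dist_powr_cball[of "- t * p" \<rho> c] \<open>0 < \<rho>\<close>
      by (simp add: w_def n_def tp)
    also have "ennreal A * ennreal (w / (p - \<delta> * p) * (\<rho> / 2) powr (p - \<delta> * p)) = ennreal (K1 * \<rho> powr (- \<delta> * p))"
    proof -
      have "A * (w / (p - \<delta> * p) * (\<rho> / 2) powr (p - \<delta> * p)) = K1 * \<rho> powr (- \<delta> * p)"
      proof -
        have "(2 / \<rho>) powr p * (\<rho> / 2) powr (p - \<delta> * p) = 2 powr (\<delta> * p) * \<rho> powr (- \<delta> * p)"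
          using \<open>0 < \<rho>\<close> by (simp add: powr_divide powr_diff powr_minus field_simps)
        then show ?thesis by (simp add: A_def K1_def)
      qed
      then show ?thesis using ABC by (simp flip: ennreal_mult')
    qed
    also have "ennreal B * ennreal (w / (\<delta> * p / 2) * (\<rho> / 2) powr (- (\<delta> * p / 2))) = ennreal (K2 * \<rho> powr (- \<delta> * p))"
    proof -
      have "\<rho> powr (\<delta> * p) = \<rho> powr (\<delta> * p / 2) * \<rho> powr (\<delta> * p / 2)"
        by (simp flip: powr_add)
      then have "B * (w / (\<delta> * p / 2) * (\<rho> / 2) powr (- (\<delta> * p / 2))) = K2 * \<rho> powr (- \<delta> * p)"
        using \<open>0 < \<rho>\<close> pos by (simp add: B_def K2_def powr_divide powr_mult powr_powr sp powr_minus field_simps)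
      then show ?thesis using ABC by (simp flip: ennreal_mult')
    qed
    also have "ennreal C * ennreal (w / (n / 2) * \<rho> powr (n / 2)) = ennreal (K3 * \<rho> powr (- \<delta> * p))"
    proof -
      have "\<rho> powr m = \<rho> powr (\<delta> * p) * \<rho> powr (n / 2) * \<rho> powr (n / 2)"
        by (simp add: m_def flip: powr_add)
      then have "C * (w / (n / 2) * \<rho> powr (n / 2)) = K3 * \<rho> powr (- \<delta> * p)"
        using \<open>0 < \<rho>\<close> pos by (simp add: C_def K3_def powr_divide powr_mult powr_powr tp powr_minus field_simps)
      then show ?thesis using ABC by (simp flip: ennreal_mult')
    qed
    finally show "(\<integral>\<^sup>+y. ennreal (\<bar>ln (max (dist c x) \<epsilon>) - ln (max (dist c y) \<epsilon>)\<bar> powr p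
          / dist x y powr (DIM('a) + \<delta> * p)) \<partial>lborel)
        \<le> ennreal ((K1 + K2 + K3) * max (dist c x) \<epsilon> powr (- \<delta> * p))"
      using K by (simp add: \<rho>_def m_def n_def distrib_right)
  qed
qed

section \<open>Cubes and the fractional maximal function\<close>

lemma mem_cube_iff: "x \<in> cube a l \<longleftrightarrow> (\<forall>i. a $ i \<le> x $ i \<and> x $ i \<le> a $ i + l)"
  by (simp add: cube_def mem_box_cart)

lemma emeasure_lborel_cube:
  fixes a :: "real ^ 'n"
  assumes "0 \<le> l"
  shows "emeasure lborel (cube a l) = ennreal (l ^ CARD('n))"
proof -
  have "(\<chi> i. a $ i + l) \<bullet> b = a \<bullet> b + l" if "b \<in> Basis" for b
    using that by (auto simp: Basis_vec_def inner_axis)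
  then have "emeasure lborel (cube a l) = ennreal (\<Prod>b\<in>(Basis :: (real ^ 'n) set). l)"
    unfolding cube_def using assms
    by (subst emeasure_lborel_cbox) (auto simp: inner_diff_left intro!: arg_cong[where f=ennreal] prod.cong)
  then show ?thesis by simp
qed

text \<open>Bounding the norm by the sum of the coordinates is cruder than the sharp factor
  \<open>sqrt (CARD('n))\<close>, but any dimensional constant serves.\<close>

lemma dist_le_of_mem_cube:
  fixes x y a :: "real ^ 'n" and l :: real
  assumes "x \<in> cube a l" "y \<in> cube a l"
  shows "dist x y \<le> CARD('n) * l"
proof -
  have "\<bar>(x - y) $ i\<bar> \<le> l" for i
  proof -
    have "a $ i \<le> x $ i \<and> x $ i \<le> a $ i + l" "a $ i \<le> y $ i \<and> y $ i \<le> a $ i + l"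
      using assms by (auto simp: mem_cube_iff)
    then show ?thesis by (auto simp: abs_le_iff)
  qed
  then have "(\<Sum>i\<in>UNIV. \<bar>(x - y) $ i\<bar>) \<le> of_nat (card (UNIV :: 'n set)) * l"
    by (intro sum_bounded_above) auto
  then show ?thesis
    using norm_le_l1_cart[of "x - y"] by (simp add: dist_norm)
qed

lemma cball_subset_cube:
  fixes a :: "real ^ 'n"
  shows "cball (\<chi> i. a $ i + l / 2) (l / 2) \<subseteq> cube a l"
proof
  fix x assume x: "x \<in> cball (\<chi> i. a $ i + l / 2) (l / 2)"
  have "a $ i \<le> x $ i \<and> x $ i \<le> a $ i + l" for i
  proof -
    have "\<bar>((\<chi> i. a $ i + l / 2) - x) $ i\<bar> \<le> l / 2"
      using component_le_norm_cart[of "(\<chi> i. a $ i + l / 2) - x" i] x by (simp add: dist_norm)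
    then show ?thesis by (auto simp: abs_le_iff field_simps)
  qed
  then show "x \<in> cube a l" by (simp add: mem_cube_iff)
qed

lemma cube_in_borel [measurable]: "cube a l \<in> sets borel"
  by (simp add: cube_def)

lemma ennpowr_ennreal: "0 \<le> x \<Longrightarrow> ennpowr (ennreal x) r = ennreal (x powr r)"
  by (simp add: ennpowr_def)

lemma ennpowr_mono:
  assumes "x \<le> y" "0 \<le> r"
  shows "ennpowr x r \<le> ennpowr y r"
proof (cases "y = \<infinity>")
  case False
  then have "x \<noteq> \<infinity>" using assms(1) by (auto simp: top_unique)
  then show ?thesis
    using False assms by (auto simp: ennpowr_def less_top intro!: ennreal_leI powr_mono2 enn2real_mono)
qed (simp add: ennpowr_def)

text \<open>Only cubes meeting the ball carry mass, and one that also contains \<open>x\<close> has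
  side at least comparable to the distance from \<open>x\<close> to the ball. As
  \<open>\<alpha> - CARD('n)\<close> is nonpositive, longer cubes give no larger bound; for cubes
  shorter than \<open>\<epsilon>\<close> the bounded density takes over.\<close>

lemma frac_maximal_uniform_cball_le:
  fixes c x :: "real ^ 'n" and \<alpha> \<epsilon> :: real
  assumes "0 \<le> \<alpha>" "\<alpha> \<le> CARD('n)" "0 < \<epsilon>"
  shows "frac_maximal \<alpha> (uniform_measure lborel (cball c \<epsilon>)) x \<le>
    ennreal ((1 + CARD('n)) powr (CARD('n) - \<alpha>) * (1 + 1 / unit_ball_vol CARD('n))
      * max (dist c x) \<epsilon> powr (\<alpha> - CARD('n)))"
proof -
  define n where "n = real CARD('n)"
  define v where "v = unit_ball_vol n"
  define \<rho> where "\<rho> = max (dist c x) \<epsilon>"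
  let ?\<mu> = "uniform_measure lborel (cball c \<epsilon>)"
  have pos: "0 < n" "0 < v" "0 < \<rho>" using assms by (auto simp: n_def v_def \<rho>_def)
  have ball: "emeasure lborel (cball c \<epsilon>) = ennreal (v * \<epsilon> ^ CARD('n))"
    using assms by (simp add: emeasure_cball v_def n_def)
  have "ennreal (l powr \<alpha>) * (emeasure ?\<mu> (cube a l) / emeasure lborel (cube a l))
      \<le> ennreal ((1 + n) powr (n - \<alpha>) * (1 + 1 / v) * \<rho> powr (\<alpha> - n))"
    if "0 < l" "x \<in> cube a l" for a l
  proof (cases "cball c \<epsilon> \<inter> cube a l = {}")
    case True
    then show ?thesis by simp
  next
    case False
    then obtain z where z: "dist c z \<le> \<epsilon>" "z \<in> cube a l" by auto
    have "dist c x \<le> \<epsilon> + n * l"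
      using dist_triangle[of c x z] z dist_le_of_mem_cube[OF z(2) \<open>x \<in> cube a l\<close>] by (simp add: n_def)
    moreover have "0 \<le> n * l" using pos \<open>0 < l\<close> by simp
    ultimately have \<rho>_le: "\<rho> \<le> \<epsilon> + n * l" by (simp add: \<rho>_def)
    \<comment> \<open>The nonpositive exponent reverses \<open>\<rho> \<le> (1 + n) * r\<close>. It
      is applied with \<open>r = l\<close> for long cubes and \<open>r = \<epsilon>\<close> for
      short ones.\<close>
    have scale: "r powr (\<alpha> - n) \<le> (1 + n) powr (n - \<alpha>) * \<rho> powr (\<alpha> - n)" if "\<rho> \<le> (1 + n) * r" "0 < r" for r
    proof -
      have "((1 + n) * r) powr (\<alpha> - n) \<le> \<rho> powr (\<alpha> - n)"
        using that pos assms by (intro powr_mono2') (auto simp: n_def)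
      then have "(1 + n) powr (n - \<alpha>) * ((1 + n) * r) powr (\<alpha> - n) \<le> (1 + n) powr (n - \<alpha>) * \<rho> powr (\<alpha> - n)"
        by (intro mult_left_mono) auto
      moreover have "(1 + n) powr (n - \<alpha>) * (1 + n) powr (\<alpha> - n) = 1"
        using pos by (simp flip: powr_add)
      ultimately show ?thesis
        using pos that by (simp add: powr_mult flip: mult.assoc)
    qed
    have ln: "l ^ CARD('n) = l powr n" "\<epsilon> ^ CARD('n) = \<epsilon> powr n"
      using \<open>0 < l\<close> \<open>0 < \<epsilon>\<close> by (auto simp: n_def powr_realpow)
    have cube: "emeasure lborel (cube a l) = ennreal (l powr n)"
      using \<open>0 < l\<close> by (simp add: emeasure_lborel_cube ln)
    have "emeasure ?\<mu> (cube a l) = emeasure lborel (cball c \<epsilon> \<inter> cube a l) / ennreal (v * \<epsilon> powr n)"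
      by (simp add: ball ln)
    moreover have "emeasure lborel (cball c \<epsilon> \<inter> cube a l) \<le> ennreal (min (v * \<epsilon> powr n) (l powr n))"
      using emeasure_mono[of "cball c \<epsilon> \<inter> cube a l" "cball c \<epsilon>" lborel]
        emeasure_mono[of "cball c \<epsilon> \<inter> cube a l" "cube a l" lborel]
      by (simp add: min_def ball cube ln)
    ultimately have "emeasure ?\<mu> (cube a l) \<le> ennreal (min (v * \<epsilon> powr n) (l powr n)) / ennreal (v * \<epsilon> powr n)"
      by (simp add: divide_right_mono_ennreal)
    then have "ennreal (l powr \<alpha>) * (emeasure ?\<mu> (cube a l) / emeasure lborel (cube a l)) \<le>
        ennreal (l powr \<alpha>) * (ennreal (min (v * \<epsilon> powr n) (l powr n)) / ennreal (v * \<epsilon> powr n) / ennreal (l powr n))"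
      unfolding cube by (intro mult_left_mono divide_right_mono_ennreal) auto
    also have "\<dots> = ennreal (l powr \<alpha> * (min (v * \<epsilon> powr n) (l powr n) / (v * \<epsilon> powr n) / l powr n))"
      using pos \<open>0 < l\<close> \<open>0 < \<epsilon>\<close> by (simp add: divide_ennreal flip: ennreal_mult)
    also have "\<dots> \<le> ennreal ((1 + n) powr (n - \<alpha>) * (1 + 1 / v) * \<rho> powr (\<alpha> - n))"
    proof (rule ennreal_leI)
      show "l powr \<alpha> * (min (v * \<epsilon> powr n) (l powr n) / (v * \<epsilon> powr n) / l powr n)
        \<le> (1 + n) powr (n - \<alpha>) * (1 + 1 / v) * \<rho> powr (\<alpha> - n)"
      \<comment> \<open>For a long cube the mass is bounded by 1, for a short one by volume times
        density, together with \<open>l powr \<alpha> \<le> \<epsilon> powr \<alpha>\<close>. The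
        factor \<open>1 + 1 / v\<close> dominates the constants 1 and \<open>1 / v\<close> of the
        two cases.\<close>
      proof (cases "\<epsilon> \<le> l")
        case True
        have "l powr \<alpha> * (min (v * \<epsilon> powr n) (l powr n) / (v * \<epsilon> powr n) / l powr n)
            \<le> l powr \<alpha> * (1 / l powr n)"
          using pos \<open>0 < \<epsilon>\<close> by (intro mult_left_mono divide_right_mono) auto
        also have "\<dots> = l powr (\<alpha> - n)" by (simp add: powr_diff)
        also have "\<dots> \<le> (1 + n) powr (n - \<alpha>) * \<rho> powr (\<alpha> - n)"
          using True \<open>0 < l\<close> \<rho>_le by (intro scale) (auto simp: algebra_simps)
        also have "\<dots> \<le> (1 + n) powr (n - \<alpha>) * \<rho> powr (\<alpha> - n) * (1 + 1 / v)"
          using pos mult_left_mono[of 1 "1 + 1 / v" "(1 + n) powr (n - \<alpha>) * \<rho> powr (\<alpha> - n)"] by simp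
        finally show ?thesis by (simp add: mult_ac)
      next
        case False
        have "l powr \<alpha> * (min (v * \<epsilon> powr n) (l powr n) / (v * \<epsilon> powr n) / l powr n)
            \<le> \<epsilon> powr \<alpha> * (l powr n / (v * \<epsilon> powr n) / l powr n)"
          using pos False \<open>0 < l\<close> assms by (intro mult_mono divide_right_mono powr_mono2) auto
        also have "\<dots> = \<epsilon> powr (\<alpha> - n) * (1 / v)"
          using \<open>0 < l\<close> by (simp add: powr_diff)
        also have "\<dots> \<le> ((1 + n) powr (n - \<alpha>) * \<rho> powr (\<alpha> - n)) * (1 + 1 / v)"
        proof (intro mult_mono scale)
          have "n * l \<le> n * \<epsilon>" using False pos by (intro mult_left_mono) auto
          then show "\<rho> \<le> (1 + n) * \<epsilon>" using \<rho>_le by (simp add: algebra_simps)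
        qed (use pos assms in auto)
        finally show ?thesis by (simp add: mult_ac)
      qed
    qed
    finally show ?thesis .
  qed
  then show ?thesis
    unfolding frac_maximal_def n_def v_def \<rho>_def by (intro SUP_least) auto
qed

section \<open>Regularity of the test measure and of the test function\<close>

text \<open>Finite Borel measures on a Polish space are inner regular with respect to compact
  sets.\<close>

lemma radon_measure_finite_borel:
  fixes M :: "'a::{second_countable_topology, complete_space} measure"
  assumes "sets M = sets borel" "emeasure M (space M) \<noteq> \<infinity>"
  shows "radon_measure M"
proof -
  have "emeasure M K < \<infinity>" if "compact K" for K
  proof -
    have "emeasure M K \<le> emeasure M (space M)"
      by (rule emeasure_space)
    then show ?thesis using assms(2) by (auto simp: less_top[symmetric] top_unique)
  qed
  then show ?thesis
    unfolding radon_measure_def using assms inner_regular[OF assms] by auto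
qed

text \<open>Truncation only lowers the function, and \<open>- ln (dist c x)\<close> has a locally
  integrable majorant, so the upper bound is uniform in \<open>\<epsilon>\<close>. The average
  therefore cannot follow the peak of the function at \<open>c\<close>.\<close>

lemma neg_truncated_log_average_bounded:
  fixes c :: "real ^ 'n"
  assumes "0 < l" "c \<in> cube a l"
  obtains A where "\<And>\<epsilon>. 0 < \<epsilon> \<Longrightarrow> average (cube a l) (\<lambda>x. - ln (max (dist c x) \<epsilon>)) \<le> A"
proof -
  define n where "n = real CARD('n)"
  \<comment> \<open>The exponent \<open>- (1 / 2)\<close> is integrable at \<open>c\<close> in every
    dimension, because \<open>1 \<le> n\<close>.\<close>
  define I where "I = n * unit_ball_vol n / (- (1 / 2) + n) * (n * l) powr (- (1 / 2) + n)"
  have "1 \<le> n" using zero_less_card_finite[where 'a='n] unfolding n_def by linarith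
  then have "0 \<le> I" by (simp add: I_def)
  have [measurable]: "cball c (n * l) \<in> sets borel" by simp
  have "(LINT x:cube a l|lborel. - ln (max (dist c x) \<epsilon>)) \<le> 2 * I" if "0 < \<epsilon>" for \<epsilon>
    unfolding set_lebesgue_integral_def
  proof (rule integral_real_bounded)
    \<comment> \<open>\<open>ennreal\<close> cuts off negative values, so only the positive part of
      the integrand has to be bounded.\<close>
    have "(\<integral>\<^sup>+x. ennreal (indicat_real (cube a l) x *\<^sub>R - ln (max (dist c x) \<epsilon>)) \<partial>lborel)
        \<le> (\<integral>\<^sup>+x. ennreal 2 * (ennreal (dist c x powr - (1 / 2)) * indicator (cball c (n * l)) x) \<partial>lborel)"
    proof (rule nn_integral_mono_AE, rule AE_mp[OF AE_lborel_singleton[of c]], rule AE_I2, rule impI)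
      fix x assume "x \<noteq> c"
      show "ennreal (indicat_real (cube a l) x *\<^sub>R - ln (max (dist c x) \<epsilon>))
        \<le> ennreal 2 * (ennreal (dist c x powr - (1 / 2)) * indicator (cball c (n * l)) x)"
      proof (cases "x \<in> cube a l")
        case True
        have d: "0 < dist c x" using \<open>x \<noteq> c\<close> by simp
        have "- ln (max (dist c x) \<epsilon>) \<le> - ln (dist c x)"
          using d \<open>0 < \<epsilon>\<close> by simp
        also have "\<dots> = 2 * ln (dist c x powr - (1 / 2))"
          using d by (simp add: ln_powr)
        also have "\<dots> \<le> 2 * dist c x powr - (1 / 2)"
          using d ln_le_minus_one[of "dist c x powr - (1 / 2)"] by simp
        finally have "ennreal (- ln (max (dist c x) \<epsilon>)) \<le> ennreal (2 * dist c x powr - (1 / 2))"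
          by (rule ennreal_leI)
        moreover have "x \<in> cball c (n * l)"
          using dist_le_of_mem_cube[OF \<open>c \<in> cube a l\<close> True] by (simp add: n_def)
        ultimately show ?thesis using True by (simp add: ennreal_mult)
      qed simp
    qed
    also have "\<dots> = ennreal 2 * (\<integral>\<^sup>+x. ennreal (dist c x powr - (1 / 2)) * indicator (cball c (n * l)) x \<partial>lborel)"
      by (rule nn_integral_cmult) measurable
    also have "(\<integral>\<^sup>+x. ennreal (dist c x powr - (1 / 2)) * indicator (cball c (n * l)) x \<partial>lborel) = ennreal I"
    proof -
      have dim: "real DIM(real ^ 'n) = n" by (simp add: n_def)
      show ?thesis
        unfolding I_def using \<open>1 \<le> n\<close> \<open>0 < l\<close>
        by (subst nn_integral_dist_powr_cball) (simp_all only: dim, simp_all)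
    qed
    also have "ennreal 2 * ennreal I = ennreal (2 * I)"
      using \<open>0 \<le> I\<close> by (simp add: ennreal_mult)
    finally show "(\<integral>\<^sup>+x. ennreal (indicat_real (cube a l) x *\<^sub>R - ln (max (dist c x) \<epsilon>)) \<partial>lborel) \<le> ennreal (2 * I)" .
  qed (use \<open>0 \<le> I\<close> in simp)
  then have "average (cube a l) (\<lambda>x. - ln (max (dist c x) \<epsilon>)) \<le> 2 * I / measure lborel (cube a l)" if "0 < \<epsilon>" for \<epsilon>
    using that unfolding average_def by (intro divide_right_mono) auto
  then show thesis by (rule that)
qed

text \<open>The truncated distance is 1-Lipschitz with values in \<open>{\<epsilon>..}\<close>,
  where the logarithm has Lipschitz constant \<open>1 / \<epsilon>\<close>.\<close>

lemma lipschitz_neg_truncated_log: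
  assumes "0 < \<epsilon>"
  shows "(1 / \<epsilon>)-lipschitz_on UNIV (\<lambda>x. - ln (max (dist c x) \<epsilon>))"
proof (rule lipschitz_onI)
  fix x y :: 'a
  let ?r = "\<lambda>x. max (dist c x) \<epsilon>"
  have r: "\<bar>?r x - ?r y\<bar> \<le> dist x y"
    using dist_triangle[of c x y] dist_triangle[of c y x] by (auto simp: dist_commute max_def)
  have "ln (?r u) - ln (?r w) \<le> 1 / \<epsilon> * dist x y" if "\<bar>?r u - ?r w\<bar> \<le> dist x y" for u w
  proof -
    have "ln (?r u) - ln (?r w) \<le> (?r u - ?r w) / ?r w"
      using assms by (intro ln_diff_le) auto
    also have "\<dots> \<le> dist x y / \<epsilon>"
      using assms that by (intro frac_le) auto
    finally show ?thesis by simp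
  qed
  from this[of x y] this[of y x] r show "dist (- ln (?r x)) (- ln (?r y)) \<le> 1 / \<epsilon> * dist x y"
    by (auto simp: dist_real_def abs_le_iff)
qed (use assms in simp)

section \<open>Choice of the truncation and comparison of the two sides\<close>

lemma eventually_affine_powr_less:
  fixes A B u v r :: real
  assumes "0 < v" "0 < r" "r < 1"
  shows "eventually (\<lambda>L. B * (u + v * L) powr r < L - A) at_top"
  using assms by real_asymp

theorem mainTheorem8:
  fixes Q :: "(real ^ 'n) set" and \<delta> p q \<alpha> C :: real
  assumes "is_cube Q"
    and "0 < \<delta>" and "\<delta> < 1"
    and "1 < p" and "p < min (real CARD('n) / \<delta>) (1 / (1 - \<delta>))"
    and "p \<le> q" and "q \<le> real CARD('n) * p / (real CARD('n) - \<delta> * p)"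
    and "\<alpha> = real CARD('n) - q / p * (real CARD('n) - \<delta> * p)"
    and "C > 0"
  shows "\<exists>(\<mu> :: (real ^ 'n) measure) (f :: real ^ 'n \<Rightarrow> real).
    radon_measure \<mu> \<and> absolutely_continuous lborel \<mu> \<and> (\<exists>L. L-lipschitz_on UNIV f) \<and>
    ennpowr (\<integral>\<^sup>+x\<in>Q. ennreal (\<bar>f x - average Q f\<bar> powr q) \<partial>\<mu>) (1 / q) >
    ennreal (C * (1 - \<delta>) powr (1 / p)) *
    ennpowr
      (\<integral>\<^sup>+x\<in>Q.
         (\<integral>\<^sup>+y\<in>Q. ennreal (\<bar>f x - f y\<bar> powr p / norm (x - y) powr (real CARD('n) + \<delta> * p)) \<partial>lborel)
         * ennpowr (frac_maximal \<alpha> \<mu> x) (p / q) \<partial>lborel)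
      (1 / p)"
proof -
  define n where "n = real CARD('n)"
  have "1 \<le> n" using zero_less_card_finite[where 'a='n] unfolding n_def by linarith
  have "0 < p" "0 < q" using assms by auto
  have "\<delta> * p < n"
    using assms by (simp add: n_def pos_less_divide_eq mult.commute)
  \<comment> \<open>The upper bound on \<open>q\<close> amounts to \<open>0 \<le> \<alpha>\<close>.
    The last identity is the criticality that makes the powers of \<open>r x\<close> combine to
    \<open>- n\<close> below.\<close>
  have \<alpha>: "0 \<le> \<alpha>" "\<alpha> \<le> n" "(\<alpha> - n) * (p / q) = \<delta> * p - n"
  proof -
    have "q * (n - \<delta> * p) \<le> n * p"
      using assms(7) \<open>\<delta> * p < n\<close> by (simp add: pos_le_divide_eq flip: n_def)
    then show "0 \<le> \<alpha>"
      using \<open>0 < p\<close> by (simp add: assms(8) pos_divide_le_eq flip: n_def)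
    show "\<alpha> \<le> n"
      using \<open>\<delta> * p < n\<close> \<open>0 < p\<close> \<open>0 < q\<close> by (simp add: assms(8) flip: n_def)
    show "(\<alpha> - n) * (p / q) = \<delta> * p - n"
      using \<open>0 < p\<close> \<open>0 < q\<close> by (simp add: assms(8) flip: n_def)
  qed
  obtain a l where "0 < l" and Q: "Q = cube a l"
    using assms(1) by (auto simp: is_cube_def)
  define c where "c = (\<chi> i. a $ i + l / 2)"
  have ball_Q: "cball c r \<subseteq> Q" if "r \<le> l / 2" for r
    using cball_subset_cube[of a l] that unfolding Q c_def by (auto intro: order_trans)
  then have "c \<in> Q" using \<open>0 < l\<close> by (auto dest!: meta_spec[of _ "0 :: real"])
  have Q_ball: "dist c x \<le> n * l" if "x \<in> Q" for x
    using dist_le_of_mem_cube that \<open>c \<in> Q\<close> by (simp add: Q n_def)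
  have [measurable]: "Q \<in> sets borel" "cball c r \<in> sets borel" for r by (auto simp: Q)
  obtain A where A: "\<And>\<epsilon>. 0 < \<epsilon> \<Longrightarrow> average Q (\<lambda>x. - ln (max (dist c x) \<epsilon>)) \<le> A"
    using neg_truncated_log_average_bounded[OF \<open>0 < l\<close> \<open>c \<in> Q\<close>[unfolded Q]] unfolding Q by blast
  obtain K where "0 \<le> K" and K: "\<And>(c :: real ^ 'n) x \<epsilon>. 0 < \<epsilon> \<Longrightarrow>
      (\<integral>\<^sup>+y. ennreal (\<bar>ln (max (dist c x) \<epsilon>) - ln (max (dist c y) \<epsilon>)\<bar> powr p
          / dist x y powr (n + \<delta> * p)) \<partial>lborel)
        \<le> ennreal (K * max (dist c x) \<epsilon> powr (- \<delta> * p))"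
    using truncated_log_energy_bound[where 'a="real ^ 'n", OF assms(2,3) \<open>0 < p\<close>] by (auto simp: n_def)
  define v where "v = unit_ball_vol n"
  define M where "M = (1 + n) powr (n - \<alpha>) * (1 + 1 / v)"
  define N where "N = K * M powr (p / q)"
  have "0 < v" "0 \<le> M" using \<open>1 \<le> n\<close> by (auto simp: v_def M_def)
  have "0 \<le> N" using \<open>0 \<le> K\<close> by (simp add: N_def)

  define B where "B = C * (1 - \<delta>) powr (1 / p)"
  define u where "u = N * (v * (1 + n * ln (n * l)))"
  \<comment> \<open>\<open>N + 1\<close> instead of \<open>N\<close> keeps the slope strictly
    positive even if \<open>N = 0\<close>, as \<open>eventually_affine_powr_less\<close>
    demands.\<close>
  define w where "w = (N + 1) * (v * n)"
  have "\<forall>\<^sub>F L in at_top. B * (u + w * L) powr (1 / p) < L - A"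
    using \<open>0 < v\<close> \<open>1 \<le> n\<close> \<open>0 \<le> N\<close> \<open>1 < p\<close> unfolding w_def
    by (intro eventually_affine_powr_less) auto
  \<comment> \<open>The last condition on \<open>L\<close> puts the ball of radius
    \<open>exp (- L)\<close> inside \<open>Q\<close>.\<close>
  then obtain L where L: "B * (u + w * L) powr (1 / p) < L - A" "0 \<le> L" "- ln (l / 2) \<le> L"
    using eventually_happens[OF eventually_conj[OF _ eventually_conj[OF eventually_ge_at_top[of 0] eventually_ge_at_top[of "- ln (l / 2)"]]]]
    by auto
  define \<epsilon> where "\<epsilon> = exp (- L)"
  have "0 < \<epsilon>" "ln \<epsilon> = - L" by (auto simp: \<epsilon>_def)
  have "ln \<epsilon> \<le> ln (l / 2)" using L by (simp add: \<epsilon>_def)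
  then have "\<epsilon> \<le> l / 2" using \<open>0 < \<epsilon>\<close> \<open>0 < l\<close> by (simp only: ln_le_cancel_iff)
  have "l / 2 \<le> n * l" using \<open>1 \<le> n\<close> \<open>0 < l\<close> mult_right_mono[of "1 / 2" n l] by simp
  define \<mu> where "\<mu> = uniform_measure lborel (cball c \<epsilon>)"
  define r where "r x = max (dist c x) \<epsilon>" for x
  define f where "f x = - ln (r x)" for x
  have "0 < r x" for x using \<open>0 < \<epsilon>\<close> by (simp add: r_def)
  have sets_\<mu>: "sets \<mu> = sets borel" by (simp add: \<mu>_def)
  have \<mu>_ball: "emeasure \<mu> (cball c \<epsilon>) = 1"
  proof -
    have "emeasure lborel (cball c \<epsilon>) = ennreal (v * \<epsilon> ^ CARD('n))"
      using \<open>0 < \<epsilon>\<close> by (simp add: emeasure_cball v_def n_def)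
    then show ?thesis
      unfolding \<mu>_def using \<open>0 < \<epsilon>\<close> \<open>0 < v\<close> by (intro emeasure_uniform_measure_1) auto
  qed

  have "radon_measure \<mu>"
  proof (rule radon_measure_finite_borel)
    show "emeasure \<mu> (space \<mu>) \<noteq> \<infinity>"
      using \<mu>_ball \<open>0 < \<epsilon>\<close> by (simp add: \<mu>_def)
  qed (rule sets_\<mu>)
  moreover have "absolutely_continuous lborel \<mu>"
    unfolding \<mu>_def uniform_measure_def by (intro absolutely_continuousI_density) measurable
  moreover have "\<exists>L. L-lipschitz_on UNIV f"
    unfolding f_def r_def using lipschitz_neg_truncated_log \<open>0 < \<epsilon>\<close> by blast
  moreover have "ennpowr (\<integral>\<^sup>+x\<in>Q. ennreal (\<bar>f x - average Q f\<bar> powr q) \<partial>\<mu>) (1 / q) >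
    ennreal B *
    ennpowr
      (\<integral>\<^sup>+x\<in>Q.
         (\<integral>\<^sup>+y\<in>Q. ennreal (\<bar>f x - f y\<bar> powr p / norm (x - y) powr (n + \<delta> * p)) \<partial>lborel)
         * ennpowr (frac_maximal \<alpha> \<mu> x) (p / q) \<partial>lborel)
      (1 / p)" (is "?lhs > _ * ennpowr ?E _")
  proof -
    have "0 \<le> B" using assms by (simp add: B_def)
    then have "0 \<le> B * (u + w * L) powr (1 / p)" by simp
    then have "A < L" using L(1) by linarith
    \<comment> \<open>All of the unit mass sits on \<open>cball c \<epsilon>\<close>, where
      \<open>f\<close> is constantly \<open>L\<close> while its average is at most
      \<open>A\<close>.\<close>
    have lhs: "ennreal (L - A) \<le> ?lhs"
    proof -
      have "ennreal ((L - A) powr q) = (\<integral>\<^sup>+x. ennreal ((L - A) powr q) * indicator (cball c \<epsilon>) x \<partial>\<mu>)"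
        by (simp add: nn_integral_cmult_indicator sets_\<mu> \<mu>_ball)
      also have "\<dots> \<le> (\<integral>\<^sup>+x\<in>Q. ennreal (\<bar>f x - average Q f\<bar> powr q) \<partial>\<mu>)"
      proof (rule nn_integral_mono)
        fix x
        show "ennreal ((L - A) powr q) * indicator (cball c \<epsilon>) x \<le> ennreal (\<bar>f x - average Q f\<bar> powr q) * indicator Q x"
        proof (cases "x \<in> cball c \<epsilon>")
          case True
          then have "f x = L" by (simp add: f_def r_def max_def \<open>ln \<epsilon> = - L\<close>)
          moreover have "average Q f \<le> A" unfolding f_def r_def using A \<open>0 < \<epsilon>\<close> by blast
          ultimately have "(L - A) powr q \<le> \<bar>f x - average Q f\<bar> powr q"
            using \<open>A < L\<close> \<open>0 < q\<close> by (intro powr_mono2) auto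
          then show ?thesis using True ball_Q[OF \<open>\<epsilon> \<le> l / 2\<close>] by (auto intro: ennreal_leI)
        qed simp
      qed
      finally have "ennpowr (ennreal ((L - A) powr q)) (1 / q) \<le> ?lhs"
        using \<open>0 < q\<close> by (intro ennpowr_mono) auto
      then show ?thesis using \<open>A < L\<close> \<open>0 < q\<close> by (simp add: ennpowr_ennreal powr_powr)
    qed
    have "?E \<le> ennreal (u + w * L)"
    proof -
      have "?E \<le> (\<integral>\<^sup>+x. ennreal N * (ennreal (r x powr (- n)) * indicator (cball c (n * l)) x) \<partial>lborel)"
      proof (rule nn_integral_mono)
        fix x
        let ?I = "\<integral>\<^sup>+y\<in>Q. ennreal (\<bar>f x - f y\<bar> powr p / norm (x - y) powr (n + \<delta> * p)) \<partial>lborel"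
        let ?M = "ennpowr (frac_maximal \<alpha> \<mu> x) (p / q)"
        show "?I * ?M * indicator Q x \<le> ennreal N * (ennreal (r x powr (- n)) * indicator (cball c (n * l)) x)"
        proof (cases "x \<in> Q")
          case True
          \<comment> \<open>Enlarging the inner domain from \<open>Q\<close> to the whole space
            makes the global energy bound applicable.\<close>
          have "?I \<le> (\<integral>\<^sup>+y. ennreal (\<bar>ln (r x) - ln (r y)\<bar> powr p / dist x y powr (n + \<delta> * p)) \<partial>lborel)"
            by (intro nn_integral_mono) (auto simp: f_def dist_norm abs_minus_commute split: split_indicator)
          also have "\<dots> \<le> ennreal (K * r x powr (- \<delta> * p))"
            unfolding r_def using K \<open>0 < \<epsilon>\<close> by blast
          finally have I: "?I \<le> ennreal (K * r x powr (- \<delta> * p))" .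
          have "frac_maximal \<alpha> \<mu> x \<le> ennreal (M * r x powr (\<alpha> - n))"
            using frac_maximal_uniform_cball_le[of \<alpha> \<epsilon> c x] \<alpha> \<open>0 < \<epsilon>\<close>
            unfolding M_def \<mu>_def v_def r_def n_def by simp
          then have "?M \<le> ennpowr (ennreal (M * r x powr (\<alpha> - n))) (p / q)"
            using \<open>0 < p\<close> \<open>0 < q\<close> by (intro ennpowr_mono) auto
          also have "\<dots> = ennreal (M powr (p / q) * r x powr (\<delta> * p - n))"
            using \<open>0 \<le> M\<close> \<open>0 < r x\<close> by (simp only: ennpowr_ennreal powr_mult powr_powr \<alpha>(3) mult_nonneg_nonneg powr_ge_zero)
          finally have "?I * ?M \<le> ennreal (K * r x powr (- \<delta> * p)) * ennreal (M powr (p / q) * r x powr (\<delta> * p - n))"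
            using I by (intro mult_mono) auto
          also have "\<dots> = ennreal (N * r x powr (- n))"
          proof -
            have "r x powr (- \<delta> * p) * r x powr (\<delta> * p - n) = r x powr (- n)"
              by (simp flip: powr_add)
            then have "K * r x powr (- \<delta> * p) * (M powr (p / q) * r x powr (\<delta> * p - n)) = N * r x powr (- n)"
              unfolding N_def by (metis mult.assoc mult.left_commute)
            then show ?thesis using \<open>0 \<le> K\<close> by (simp flip: ennreal_mult)
          qed
          finally show ?thesis using True Q_ball[OF True] \<open>0 \<le> N\<close> by (simp add: ennreal_mult)
        qed simp
      qed
      also have "\<dots> = ennreal N * (\<integral>\<^sup>+x. ennreal (r x powr (- n)) * indicator (cball c (n * l)) x \<partial>lborel)"
        unfolding r_def by (rule nn_integral_cmult) measurable
      also have "\<dots> \<le> ennreal N * ennreal (v * (1 + n * ln (n * l / \<epsilon>)))"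
        using nn_integral_truncated_critical_powr[of \<epsilon> "n * l" c] \<open>0 < \<epsilon>\<close> \<open>\<epsilon> \<le> l / 2\<close> \<open>l / 2 \<le> n * l\<close>
        unfolding r_def v_def n_def by (intro mult_left_mono) auto
      also have "\<dots> \<le> ennreal (u + w * L)"
      proof -
        have "N * (v * (1 + n * ln (n * l / \<epsilon>))) = u + N * (v * n) * L"
          using \<open>0 < \<epsilon>\<close> \<open>0 < l\<close> \<open>1 \<le> n\<close> by (simp add: u_def ln_div \<open>ln \<epsilon> = - L\<close> algebra_simps)
        also have "\<dots> \<le> u + w * L"
          unfolding w_def using \<open>0 < v\<close> \<open>1 \<le> n\<close> \<open>0 \<le> L\<close> by (intro add_left_mono mult_right_mono) auto
        finally show ?thesis using \<open>0 \<le> N\<close> by (simp add: ennreal_leI flip: ennreal_mult')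
      qed
      finally show ?thesis .
    qed
    \<comment> \<open>\<open>max 0\<close> supplies the nonnegativity that
      \<open>ennpowr_ennreal\<close> asks for. Should it take the value 0, the final comparison
      reduces to \<open>A < L\<close>.\<close>
    then have "?E \<le> ennreal (max 0 (u + w * L))"
      by (rule order_trans) (simp add: ennreal_leI)
    then have "ennpowr ?E (1 / p) \<le> ennpowr (ennreal (max 0 (u + w * L))) (1 / p)"
      using \<open>0 < p\<close> by (intro ennpowr_mono) auto
    also have "\<dots> = ennreal (max 0 (u + w * L) powr (1 / p))"
      by (rule ennpowr_ennreal) simp
    finally have "ennpowr ?E (1 / p) \<le> ennreal (max 0 (u + w * L) powr (1 / p))" .
    then have "ennreal B * ennpowr ?E (1 / p) \<le> ennreal B * ennreal (max 0 (u + w * L) powr (1 / p))"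
      by (rule mult_left_mono) simp
    also have "\<dots> = ennreal (B * max 0 (u + w * L) powr (1 / p))"
      using \<open>0 \<le> B\<close> by (simp add: ennreal_mult)
    also have "\<dots> < ennreal (L - A)"
    proof (rule ennreal_lessI)
      show "B * max 0 (u + w * L) powr (1 / p) < L - A"
        using L(1) \<open>A < L\<close> by (auto simp: max_def)
    qed (use \<open>A < L\<close> in simp)
    also note lhs
    finally show ?thesis .
  qed
  ultimately show ?thesis unfolding B_def n_def by blast
qed

end
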